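(* Let $r\ge 2$ and let $\mathcal{H}$ be an $r$-partite $r$-uniform intersecting hypergraph. Then at least $\big(1-\frac{r-2}{(r-1)^2}\big)\cdot |E(\mathcal{H})|$ hyperedges of $\mathcal{H}$ can be covered by a multi-colored set of size $r-1$, and this bound is sharp for infinitely many values of $r$. Moreover, the cover can be chosen so that it is a subset of some hyperedge of $\mathcal{H}$.
   Context: A hypergraph $\mathcal{H}$ has a finite vertex set and a multiset $E(\mathcal{H})$ of subsets (hyperedges), counted with multiplicity. It is $r$-uniform if every hyperedge has $r$ vertices; $r$-partite if its vertex set has a partition into $r$ nonempty classes such that no hyperedge contains two vertices from the same class; intersecting if every two hyperedges share a vertex. A set of vertices is multi-colored if it meets every class in at most one vertex. A hyperedge is covered by a set $T$ if it intersects $T$. Sharpness means that for infinitely many $r$ there exist such hypergraphs in which no multi-colored set of size $r-1$ covers more than $\big(1-\frac{r-2}{(r-1)^2}\big)\cdot |E(\mathcal{H})|$ hyperedges. *)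

theory Defs
  imports Complex_Main "HOL-Library.Multiset" "HOL-Library.Disjoint_Sets"
begin

definition hypergraph :: "'a set \<Rightarrow> 'a set multiset \<Rightarrow> bool" where
  "hypergraph V E \<longleftrightarrow> finite V \<and> (\<forall>e\<in>#E. e \<subseteq> V)"

definition uniform :: "nat \<Rightarrow> 'a set multiset \<Rightarrow> bool" where
  "uniform r E \<longleftrightarrow> (\<forall>e\<in>#E. card e = r)"

definition intersecting :: "'a set multiset \<Rightarrow> bool" where
  "intersecting E \<longleftrightarrow> (\<forall>e\<in>#E. \<forall>f\<in>#E. e \<inter> f \<noteq> {})"

(* Not card (T \<inter> C) \<le> 1, which would also hold for infinite T \<inter> C. *)
definition multicolored :: "'a set \<Rightarrow> 'a set set \<Rightarrow> 'a set \<Rightarrow> bool" where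
  "multicolored V P T \<longleftrightarrow> T \<subseteq> V \<and> (\<forall>C\<in>P. \<forall>x\<in>T \<inter> C. \<forall>y\<in>T \<inter> C. x = y)"

(* partition_on already makes the classes nonempty. *)
definition partite_by :: "nat \<Rightarrow> 'a set \<Rightarrow> 'a set multiset \<Rightarrow> 'a set set \<Rightarrow> bool" where
  "partite_by r V E P \<longleftrightarrow>
     partition_on V P \<and> card P = r \<and> (\<forall>e\<in>#E. multicolored V P e)"

definition num_covered :: "'a set multiset \<Rightarrow> 'a set \<Rightarrow> nat" where
  "num_covered E T = size {# e \<in># E. e \<inter> T \<noteq> {} #}"

end

theory Submission
  imports Defs "HOL-Computational_Algebra.Primes" "HOL-Number_Theory.Cong"
begin

text \<open>
  Put \<open>k = r - 1\<close> and \<open>t = (k - 1) / k\<^sup>2\<close>, and normalise the number of edges to \<open>1\<close>. The set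
  \<open>e - {v}\<close> misses exactly the edges that meet \<open>e\<close> in \<open>v\<close> alone, so suppose that for every edge
  \<open>e\<close> and every \<open>v\<close> in \<open>e\<close> the proportion of these exceeds \<open>t\<close>. The edges through \<open>u\<close> in \<open>e\<close> are
  disjoint from those meeting \<open>e\<close> only in some \<open>v \<noteq> u\<close>, so every degree is below \<open>1 - k t = 1 / k\<close>,
  and every class has at least \<open>k + 1\<close> vertices of positive degree. If an edge \<open>e\<close> contains \<open>u\<close>
  and \<open>v\<close>, the edges through both are among those through \<open>v\<close> that do not meet \<open>e\<close> in \<open>v\<close> alone,
  hence \<open>d u v < d v - t\<close>. Summing over a class that does not contain \<open>u\<close> gives
  \<open>t < d u < 1 - (k + 1) t = 1 / k\<^sup>2\<close>, which is impossible for \<open>k \<ge> 2\<close>.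
  For \<open>k = 1\<close>, edges that meet \<open>e\<close> in its two different vertices alone would be disjoint.

  Sharpness is witnessed by projective planes of prime order \<open>p\<close> with one point removed: there are
  \<open>p\<^sup>2\<close> edges, all degrees are \<open>p\<close>, and two vertices of different classes lie on a common edge.
\<close>

subsection \<open>Covering by an edge minus a vertex\<close>

lemma sum_size_filter_mset:
  assumes "finite A"
  shows "(\<Sum>v\<in>A. size {#f \<in># E. Q v f#}) = (\<Sum>f\<in>#E. card {v\<in>A. Q v f})"
proof (induction E)
  case empty
  then show ?case by simp
next
  case (add f E)
  have "(\<Sum>v\<in>A. size {#f \<in># add_mset f E. Q v f#})
      = (\<Sum>v\<in>A. size {#f \<in># E. Q v f#} + (if Q v f then 1 else 0))"
    by (rule sum.cong) auto
  also have "\<dots> = (\<Sum>v\<in>A. size {#f \<in># E. Q v f#}) + card {v\<in>A. Q v f}"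
    using assms by (simp add: sum.distrib sum.If_cases Int_def)
  finally show ?case
    using add by simp
qed

lemma sum_size_filter_mset_le:
  assumes "finite A" and "\<And>f. f \<in># E \<Longrightarrow> card {v\<in>A. Q v f} \<le> 1"
  shows "(\<Sum>v\<in>A. size {#f \<in># E. Q v f#}) \<le> size E"
proof -
  have "(\<Sum>f\<in>#E. card {v\<in>A. Q v f}) \<le> (\<Sum>f\<in>#E. 1)"
    by (rule sum_mset_mono) (use assms in auto)
  then show ?thesis
    by (simp add: sum_size_filter_mset[OF assms(1)])
qed

lemma sum_size_filter_mset_eq:
  assumes "finite A" and "\<And>f. f \<in># E \<Longrightarrow> card {v\<in>A. Q v f} = 1"
  shows "(\<Sum>v\<in>A. size {#f \<in># E. Q v f#}) = size E"
proof -
  have "image_mset (\<lambda>f. card {v\<in>A. Q v f}) E = image_mset (\<lambda>f. 1) E"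
    by (rule image_mset_cong) (use assms in auto)
  then show ?thesis
    by (simp add: sum_size_filter_mset[OF assms(1)])
qed

lemma size_filter_mset_mono:
  assumes "\<And>f. f \<in># E \<Longrightarrow> Q f \<Longrightarrow> R f"
  shows "size (filter_mset Q E) \<le> size (filter_mset R E)"
  by (rule size_mset_mono, rule filter_mset_mono_strong) (use assms in simp_all)

lemma size_filter_mset_disjoint_le:
  assumes "\<And>f. f \<in># E \<Longrightarrow> Q f \<Longrightarrow> \<not> R f" and "\<And>f. f \<in># E \<Longrightarrow> Q f \<or> R f \<Longrightarrow> S f"
  shows "size (filter_mset Q E) + size (filter_mset R E) \<le> size (filter_mset S E)"
  using assms
proof (induction E)
  case (add f E)
  have "size (filter_mset Q E) + size (filter_mset R E) \<le> size (filter_mset S E)"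
    using add by simp
  then show ?case
    using add.prems[of f] by auto
qed simp

text \<open>An edge has at most one vertex in each of the \<open>r\<close> classes and
  \<open>r\<close> vertices in all, so it cannot miss a class.\<close>

lemma card_Int_class:
  assumes "finite V" "partite_by r V E P" "uniform r E" "e \<in># E" "C \<in> P"
  shows "card (e \<inter> C) = 1"
proof -
  have part: "partition_on V P" and cP: "card P = r" and mc: "multicolored V P e"
    using assms by (auto simp: partite_by_def)
  have eV: "e \<subseteq> V" and ce: "card e = r"
    using mc assms by (auto simp: multicolored_def uniform_def)
  have finP: "finite P"
    using part assms(1) by (rule finite_elements[rotated])
  have fin: "finite e"
    using eV assms(1) finite_subset by blast
  have le: "card (e \<inter> D) \<le> 1" if "D \<in> P" for D
    using mc that fin by (auto simp: multicolored_def card_le_Suc0_iff_eq)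
  have "e = (\<Union>D\<in>P. e \<inter> D)"
    using eV part by (auto simp: partition_on_def)
  then have "r = card (\<Union>D\<in>P. e \<inter> D)"
    using ce by simp
  also have "\<dots> \<le> (\<Sum>D\<in>P. card (e \<inter> D))"
    using finP by (rule card_UN_le)
  finally have "r \<le> (\<Sum>D\<in>P. card (e \<inter> D))" .
  also have "\<dots> = card (e \<inter> C) + (\<Sum>D\<in>P - {C}. card (e \<inter> D))"
    using finP assms(5) by (rule sum.remove)
  also have "(\<Sum>D\<in>P - {C}. card (e \<inter> D)) \<le> (\<Sum>D\<in>P - {C}. 1)"
    by (rule sum_mono) (use le in auto)
  finally have "r \<le> card (e \<inter> C) + (r - 1)"
    using cP finP assms(5) by simp
  moreover have "r > 0"
    using cP finP assms(5) card_gt_0_iff by blast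
  ultimately show ?thesis
    using le[OF assms(5)] by linarith
qed

text \<open>Supplies the set when there are no edges to take it from: one representative from each
  of \<open>n\<close> classes.\<close>

lemma exists_multicolored_card:
  assumes "partition_on V P" "finite P" "n \<le> card P"
  shows "\<exists>T. multicolored V P T \<and> card T = n"
proof -
  obtain Q where Q: "Q \<subseteq> P" "card Q = n"
    using assms by (meson obtain_subset_with_card_n)
  define h where "h C = (SOME x. x \<in> C)" for C :: "'a set"
  have h: "h C \<in> C" if "C \<in> P" for C
    using that assms(1) by (auto simp: h_def partition_on_def some_in_eq)
  have eq: "C = D" if "x \<in> C" "x \<in> D" "C \<in> P" "D \<in> P" for x C D
    using that assms(1) by (auto simp: partition_on_def disjoint_def)
  have "inj_on h Q"
    using h eq Q(1) by (metis inj_onI subsetD)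
  then have "card (h ` Q) = n"
    using Q(2) by (simp add: card_image)
  moreover have "multicolored V P (h ` Q)"
    unfolding multicolored_def
  proof (intro conjI ballI)
    show "h ` Q \<subseteq> V"
      using h Q(1) assms(1) by (auto simp: partition_on_def)
    fix C x y
    assume *: "C \<in> P" "x \<in> h ` Q \<inter> C" "y \<in> h ` Q \<inter> C"
    then obtain D D' where "D \<in> Q" "x = h D" "D' \<in> Q" "y = h D'"
      by auto
    then show "x = y"
      using * h eq Q(1) by (metis IntE subsetD)
  qed
  ultimately show ?thesis
    by blast
qed

section \<open>An edge and a vertex with few private edges\<close>

text \<open>Here \<open>k = r - 1\<close>, and denominators are cleared so that the counting stays
  in the naturals. The edges counted are those that \<open>e - {v}\<close> leaves uncovered.\<close>

lemma exists_vertex_private_bound: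
  assumes fin: "finite V" and uni: "uniform (Suc k) E" and part: "partite_by (Suc k) V E P"
    and k: "k \<ge> 1" and inter: "intersecting E" and ne: "E \<noteq> {#}"
  shows "\<exists>e\<in>#E. \<exists>v\<in>e. k\<^sup>2 * size {#f \<in># E. f \<inter> e = {v}#} \<le> (k - 1) * size E"
proof (rule ccontr)
  assume "\<not> ?thesis"
  then have big: "(k - 1) * size E < k\<^sup>2 * size {#f \<in># E. f \<inter> e = {v}#}"
    if "e \<in># E" "v \<in> e" for e v
    using that not_le by blast
  define d where "d u = size {#f \<in># E. u \<in> f#}" for u
  have partn: "partition_on V P" and cP: "card P = Suc k"
    using part by (auto simp: partite_by_def)
  have one: "card (e \<inter> C) = 1" if "e \<in># E" "C \<in> P" for e C
    using card_Int_class[OF fin part uni that] .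
  have card_e: "card e = Suc k" if "e \<in># E" for e
    using uni that by (auto simp: uniform_def)
  have fin_e: "finite e" if "e \<in># E" for e
    using card_e[OF that] card.infinite by fastforce
  have eV: "e \<subseteq> V" if "e \<in># E" for e
    using part that by (auto simp: partite_by_def multicolored_def)
  obtain e0 where e0: "e0 \<in># E"
    using ne by blast
  have N: "size E > 0"
    using ne by (simp add: nonempty_has_size)

  have deg_less: "k * d u < size E" if e: "e \<in># E" and u: "u \<in> e" for e u
  proof -
    \<comment> \<open>For \<open>v = u\<close> all edges through \<open>u\<close> count, for the
      other \<open>v\<close> only those meeting \<open>e\<close> in \<open>v\<close> alone. The
      latter avoid \<open>u\<close>, so no edge is counted twice.\<close>
    define Q where "Q = (\<lambda>v f. if v = u then u \<in> f else f \<inter> e = {v})"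
    have "v = w" if "v \<in> e" "w \<in> e" "Q v f" "Q w f" for v w f
      using that u unfolding Q_def by (metis IntI singletonD singletonI)
    then have "card {v\<in>e. Q v f} \<le> 1" for f
      by (subst One_nat_def, subst card_le_Suc0_iff_eq) (use fin_e[OF e] in auto)
    then have "(\<Sum>v\<in>e. size {#f \<in># E. Q v f#}) \<le> size E"
      by (intro sum_size_filter_mset_le fin_e e) auto
    moreover have "(\<Sum>v\<in>e. size {#f \<in># E. Q v f#})
        = d u + (\<Sum>v\<in>e-{u}. size {#f \<in># E. f \<inter> e = {v}#})"
      using u fin_e[OF e] by (simp add: sum.remove[of e u] Q_def d_def)
    ultimately have le: "d u + (\<Sum>v\<in>e-{u}. size {#f \<in># E. f \<inter> e = {v}#}) \<le> size E"
      by simp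
    have card_eu: "card (e - {u}) = k"
      using u fin_e[OF e] card_e[OF e] by simp
    then have "e - {u} \<noteq> {}"
      using k by force
    then have "(\<Sum>v\<in>e-{u}. (k - 1) * size E)
        < (\<Sum>v\<in>e-{u}. k\<^sup>2 * size {#f \<in># E. f \<inter> e = {v}#})"
      using fin_e[OF e] big[OF e] by (intro sum_strict_mono) auto
    then have "k * ((k - 1) * size E) < k\<^sup>2 * (\<Sum>v\<in>e-{u}. size {#f \<in># E. f \<inter> e = {v}#})"
      using card_eu by (simp add: sum_distrib_left)
    moreover have "k\<^sup>2 * d u + k\<^sup>2 * (\<Sum>v\<in>e-{u}. size {#f \<in># E. f \<inter> e = {v}#}) \<le> k\<^sup>2 * size E"
      using mult_left_mono[OF le, of "k\<^sup>2"] by (simp add: algebra_simps)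
    \<comment> \<open>The \<open>k\<close> vertices of \<open>e - {u}\<close> use up more than
      \<open>k * ((k - 1) * size E)\<close> of \<open>k\<^sup>2 * size E\<close>, which leaves less
      than \<open>k * size E\<close> for \<open>k\<^sup>2 * d u\<close>.\<close>
    moreover have "k\<^sup>2 * size E = k * ((k - 1) * size E) + k * size E"
      using k by (cases k) (auto simp: power2_eq_square algebra_simps)
    ultimately have "k * (k * d u) < k * size E"
      unfolding power2_eq_square mult.assoc by linarith
    then show ?thesis
      by simp
  qed

  \<comment> \<open>The estimate \<open>pair\<close> below is available only at vertices on an edge,
    so isolated vertices of a class are dropped; the degrees of the others still sum to
    \<open>size E\<close>.\<close>
  define act where "act C = {v\<in>C. \<exists>e\<in>#E. v \<in> e}" for C :: "'a set"
  have fin_act: "finite (act C)" if "C \<in> P" for C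
  proof -
    have "act C \<subseteq> V"
      using eV by (auto simp: act_def)
    then show ?thesis
      using fin finite_subset by blast
  qed
  have act_Int: "{v \<in> act C. v \<in> f} = f \<inter> C" if "f \<in># E" for f C
    using that by (auto simp: act_def)
  have sum_deg: "(\<Sum>v\<in>act C. d v) = size E" if "C \<in> P" for C
    unfolding d_def
    by (rule sum_size_filter_mset_eq[OF fin_act[OF that]]) (use one that act_Int in auto)
  have card_act: "card (act C) \<ge> Suc k" if C: "C \<in> P" for C
  proof -
    have "act C \<noteq> {}"
      using sum_deg[OF C] N by auto
    then have "(\<Sum>v\<in>act C. k * d v) < (\<Sum>v\<in>act C. size E)"
      by (intro sum_strict_mono fin_act C) (auto simp: act_def intro: deg_less)
    then have "k * size E < card (act C) * size E"
      using sum_deg[OF C] by (simp flip: sum_distrib_left)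
    then show ?thesis
      by simp
  qed

  \<comment> \<open>The nested filter presents the edges through \<open>u\<close> as a multiset of
    its own, over which the double counting is later repeated.\<close>
  have pair: "k\<^sup>2 * size {#f \<in># {#f \<in># E. u \<in> f#}. v \<in> f#} + (k - 1) * size E \<le> k\<^sup>2 * d v"
    if uv: "u \<noteq> v" and e: "e \<in># E" "v \<in> e" for u v e
  proof (cases "\<exists>g\<in>#E. u \<in> g \<and> v \<in> g")
    case True
    then obtain g where g: "g \<in># E" "u \<in> g" "v \<in> g"
      by blast
    have "size {#f \<in># E. u \<in> f \<and> v \<in> f#} + size {#f \<in># E. f \<inter> g = {v}#} \<le> d v"
      unfolding d_def using g uv by (intro size_filter_mset_disjoint_le) auto
    then have "k\<^sup>2 * (size {#f \<in># E. u \<in> f \<and> v \<in> f#} + size {#f \<in># E. f \<inter> g = {v}#}) \<le> k\<^sup>2 * d v"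
      by (rule mult_left_mono) simp
    then show ?thesis
      using big[OF g(1,3)] by (simp add: filter_filter_mset algebra_simps)
  next
    \<comment> \<open>Without a common edge the left count is 0, and any edge through
      \<open>v\<close> provides the term \<open>(k - 1) * size E\<close>.\<close>
    case False
    then have none: "{#f \<in># {#f \<in># E. u \<in> f#}. v \<in> f#} = {#}"
      by auto
    have "size {#f \<in># E. f \<inter> e = {v}#} \<le> d v"
      unfolding d_def by (rule size_filter_mset_mono) auto
    then have "k\<^sup>2 * size {#f \<in># E. f \<inter> e = {v}#} \<le> k\<^sup>2 * d v"
      by (rule mult_left_mono) simp
    then show ?thesis
      using big[OF e] unfolding none size_empty by linarith
  qed

  obtain u where u: "u \<in> e0"
    using card_e[OF e0] by fastforce
  have finP: "finite P"
    using cP card.infinite by fastforce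
  \<comment> \<open>Every edge through \<open>u\<close> has exactly one vertex in a class that
    avoids \<open>u\<close>, so the codegrees with \<open>u\<close> over this class sum to
    \<open>d u\<close>.\<close>
  obtain C where C: "C \<in> P" "u \<notin> C"
  proof -
    obtain D where D: "D \<in> P" "u \<in> D"
      using u eV[OF e0] partn by (auto simp: partition_on_def)
    have "card (P - {D}) = k"
      using cP finP D by simp
    then obtain C where "C \<in> P" "C \<noteq> D"
      using k by (metis DiffE card.empty ex_in_conv insertCI not_one_le_zero)
    then show ?thesis
      using that D partn by (auto simp: partition_on_def disjoint_def)
  qed
  have "(\<Sum>v\<in>act C. size {#f \<in># {#f \<in># E. u \<in> f#}. v \<in> f#}) = d u"
    unfolding d_def
    by (rule sum_size_filter_mset_eq[OF fin_act[OF C(1)]]) (use one C act_Int in auto)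
  moreover have "(\<Sum>v\<in>act C. k\<^sup>2 * size {#f \<in># {#f \<in># E. u \<in> f#}. v \<in> f#} + (k - 1) * size E)
      \<le> (\<Sum>v\<in>act C. k\<^sup>2 * d v)"
  proof (rule sum_mono)
    fix v assume "v \<in> act C"
    then obtain e where "e \<in># E" "v \<in> e" "u \<noteq> v"
      using C(2) by (auto simp: act_def)
    then show "k\<^sup>2 * size {#f \<in># {#f \<in># E. u \<in> f#}. v \<in> f#} + (k - 1) * size E \<le> k\<^sup>2 * d v"
      by (intro pair)
  qed
  ultimately have "k\<^sup>2 * d u + card (act C) * ((k - 1) * size E) \<le> k\<^sup>2 * size E"
    using sum_deg[OF C(1)] by (simp add: sum.distrib flip: sum_distrib_left)
  moreover have "Suc k * ((k - 1) * size E) \<le> card (act C) * ((k - 1) * size E)"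
    using card_act[OF C(1)] by (intro mult_right_mono) auto
  moreover have "(k - 1) * size E < k\<^sup>2 * d u"
  proof -
    have "size {#f \<in># E. f \<inter> e0 = {u}#} \<le> d u"
      unfolding d_def by (rule size_filter_mset_mono) auto
    then have "k\<^sup>2 * size {#f \<in># E. f \<inter> e0 = {u}#} \<le> k\<^sup>2 * d u"
      by (rule mult_left_mono) simp
    then show ?thesis
      using big[OF e0 u] by linarith
  qed
  ultimately have less: "(k - 1) * size E + Suc k * ((k - 1) * size E) < k\<^sup>2 * size E"
    by linarith
  \<comment> \<open>The factor on the left of \<open>less\<close> is
    \<open>(k - 1) * (k + 2)\<close>, that is \<open>k\<^sup>2 + k - 2\<close>. This is absurd for
    \<open>k \<ge> 2\<close>, but for \<open>k = 1\<close> it says only that there are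
    edges.\<close>
  show False
  proof (cases "k = 1")
    case False
    then obtain m where "k = Suc (Suc m)"
      using k by (metis One_nat_def not0_implies_Suc not_one_le_zero)
    then show False
      using less by (simp add: power2_eq_square algebra_simps)
  next
    case True
    have ex: "\<exists>f\<in>#E. f \<inter> e0 = {w}" if "w \<in> e0" for w
    proof (rule ccontr)
      assume "\<not> ?thesis"
      then have none: "{#f \<in># E. f \<inter> e0 = {w}#} = {#}"
        by auto
      show False
        using big[OF e0 that] unfolding none by simp
    qed
    have "card (e0 - {u}) = 1"
      using u fin_e[OF e0] card_e[OF e0] True by simp
    then obtain v where v: "e0 - {u} = {v}"
      by (auto simp: card_1_singleton_iff)
    \<comment> \<open>Let \<open>x\<close> be the vertex of \<open>e0\<close> in the class of
      \<open>w\<close>. If \<open>x = u\<close>, then \<open>f\<close> has \<open>u\<close> and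
      \<open>w\<close> in one class, so \<open>w = u\<close>, yet \<open>u\<close> is not in
      \<open>g\<close>. The case \<open>x = v\<close> is symmetric.\<close>
    obtain f g where f: "f \<in># E" "f \<inter> e0 = {u}" and g: "g \<in># E" "g \<inter> e0 = {v}"
      using ex u v by (metis DiffD1 insertI1)
    obtain w where w: "w \<in> f" "w \<in> g"
      using inter f g unfolding intersecting_def by blast
    then obtain D where D: "D \<in> P" "w \<in> D"
      using eV[OF f(1)] partn by (auto simp: partition_on_def)
    have uniq: "x = y" if "h \<in># E" "x \<in> h" "x \<in> D" "y \<in> h" "y \<in> D" for x y h
      using one[OF that(1) D(1)] that by (metis IntI card_1_singletonE singletonD)
    obtain x where "x \<in> e0" "x \<in> D"
      using one[OF e0 D(1)] by (metis IntE card_1_singletonE insertI1)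
    then have "x = u \<or> x = v"
      using v by auto
    moreover have "u \<in> f" "v \<in> g"
      using f g by auto
    ultimately have "w = u \<or> w = v"
      using uniq[of f x w] uniq[of g x w] f(1) g(1) w D(2) \<open>x \<in> D\<close> by blast
    moreover have "u \<notin> g" "v \<notin> f" "u \<noteq> v"
      using f g u v by auto
    ultimately show False
      using w by blast
  qed
qed

section \<open>From few private edges to a large cover\<close>

text \<open>Every edge meets \<open>e\<close>, so one that avoids \<open>e - {v}\<close> meets
  \<open>e\<close> exactly in \<open>v\<close>.\<close>

lemma num_covered_Diff:
  assumes "intersecting E" "e \<in># E" "v \<in> e"
  shows "num_covered E (e - {v}) + size {#f \<in># E. f \<inter> e = {v}#} = size E"
proof -
  have "{#f \<in># E. f \<inter> e = {v}#} = {#f \<in># E. \<not> f \<inter> (e - {v}) \<noteq> {}#}"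
    using assms by (intro filter_mset_cong) (auto simp: intersecting_def)
  then show ?thesis
    unfolding num_covered_def by (simp only: size_union[symmetric] multiset_partition[symmetric])
qed

lemma exists_large_multicolored_cover:
  assumes r: "r \<ge> 2" and hg: "hypergraph V E" and uni: "uniform r E"
    and part: "partite_by r V E P" and inter: "intersecting E"
  shows "\<exists>T. multicolored V P T \<and> card T = r - 1 \<and>
           real (num_covered E T) \<ge> (1 - (real r - 2) / (real r - 1)\<^sup>2) * real (size E) \<and>
           (E \<noteq> {#} \<longrightarrow> (\<exists>e\<in>#E. T \<subseteq> e))"
proof (cases "E = {#}")
  case True
  have "finite P" "partition_on V P" "r - 1 \<le> card P"
    using part r by (auto simp: partite_by_def intro!: card_ge_0_finite)
  then show ?thesis
    using exists_multicolored_card True by fastforce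
next
  case False
  obtain k where k: "r = Suc k" "k \<ge> 1"
    using r by (cases r) auto
  obtain e v where ev: "e \<in># E" "v \<in> e"
    and le: "k\<^sup>2 * size {#f \<in># E. f \<inter> e = {v}#} \<le> (k - 1) * size E"
    using exists_vertex_private_bound[of V k E P] False assms k by (auto simp: hypergraph_def)
  let ?a = "size {#f \<in># E. f \<inter> e = {v}#}"
  have "real (k\<^sup>2 * ?a) \<le> real ((k - 1) * size E)"
    using le by linarith
  then have "real ?a \<le> (real k - 1) / (real k)\<^sup>2 * real (size E)"
    using k by (simp add: field_simps)
  moreover have "real (num_covered E (e - {v})) + real ?a = real (size E)"
    using num_covered_Diff[OF inter ev] by linarith
  ultimately have "real (num_covered E (e - {v})) \<ge> (1 - (real r - 2) / (real r - 1)\<^sup>2) * real (size E)"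
    using k by (simp add: algebra_simps)
  moreover have "multicolored V P (e - {v})"
    using part ev by (auto simp: partite_by_def multicolored_def)
  moreover have "card (e - {v}) = r - 1"
    using uni ev by (simp add: uniform_def)
  ultimately show ?thesis
    using ev by blast
qed

subsection \<open>Truncated projective planes\<close>

text \<open>
  The vertex \<open>i * p + y\<close> stands for the point \<open>(i, y)\<close> with \<open>i \<le> p\<close> and \<open>y < p\<close>; its class is \<open>i\<close>.
  For \<open>i < p\<close> this is a point of the affine plane, and \<open>i = p\<close> is the line at infinity without the
  removed point, namely the common point of the classes. The edge \<open>(a, b)\<close> is \<open>y = a * i + b\<close>.
\<close>

definition line_val :: "nat \<Rightarrow> nat \<times> nat \<Rightarrow> nat \<Rightarrow> nat" where
  "line_val p ab i = (if i = p then fst ab else (fst ab * i + snd ab) mod p)"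

definition plane_edge :: "nat \<Rightarrow> nat \<times> nat \<Rightarrow> nat set" where
  "plane_edge p ab = {x. x < Suc p * p \<and> x mod p = line_val p ab (x div p)}"

text \<open>With one copy per pair \<open>(a, b)\<close>, covered edges can be counted as
  pairs.\<close>

definition plane_edges :: "nat \<Rightarrow> nat set multiset" where
  "plane_edges p = image_mset (plane_edge p) (mset_set ({..<p} \<times> {..<p}))"

definition plane_class :: "nat \<Rightarrow> nat \<Rightarrow> nat set" where
  "plane_class p i = {x. x < Suc p * p \<and> x div p = i}"

lemma line_val_less: "p > 0 \<Longrightarrow> ab \<in> {..<p} \<times> {..<p} \<Longrightarrow> line_val p ab i < p"
  by (auto simp: line_val_def)

text \<open>Lists the points of a line by class index, which gives both its size and the common
  points of two lines.\<close>

lemma plane_edge_eq_image: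
  assumes "p > 0" "ab \<in> {..<p} \<times> {..<p}"
  shows "plane_edge p ab = (\<lambda>i. i * p + line_val p ab i) ` {..p}"
proof (intro equalityI subsetI)
  fix x assume x: "x \<in> plane_edge p ab"
  then have "x div p < Suc p"
    by (auto simp: plane_edge_def intro: less_mult_imp_div_less)
  moreover have "line_val p ab (x div p) = x mod p"
    using x by (simp add: plane_edge_def)
  then have "x = x div p * p + line_val p ab (x div p)"
    by simp
  ultimately show "x \<in> (\<lambda>i. i * p + line_val p ab i) ` {..p}"
    by (intro image_eqI[of _ _ "x div p"]) (simp_all only: atMost_iff less_Suc_eq_le)
next
  fix x assume "x \<in> (\<lambda>i. i * p + line_val p ab i) ` {..p}"
  then obtain i where i: "i \<le> p" "x = i * p + line_val p ab i"
    by blast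
  note lv = line_val_less[OF assms, of i]
  have "i * p \<le> p * p"
    using i by simp
  then have "x < Suc p * p"
    using i(2) lv unfolding mult_Suc by linarith
  then show "x \<in> plane_edge p ab"
    using i lv by (simp add: plane_edge_def)
qed

lemma card_plane_edge:
  assumes "p > 0" "ab \<in> {..<p} \<times> {..<p}"
  shows "card (plane_edge p ab) = Suc p"
proof -
  have "(i * p + line_val p ab i) div p = i" for i
    using line_val_less[OF assms, of i] by simp
  then have "inj_on (\<lambda>i. i * p + line_val p ab i) {..p}"
    by (rule inj_on_inverseI)
  then show ?thesis
    by (simp add: plane_edge_eq_image[OF assms] card_image)
qed

lemma hypergraph_plane_edges: "hypergraph {..<Suc p * p} (plane_edges p)"
  by (auto simp: hypergraph_def plane_edges_def plane_edge_def)

lemma uniform_plane_edges: "p > 0 \<Longrightarrow> uniform (Suc p) (plane_edges p)"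
  by (auto simp: uniform_def plane_edges_def intro!: card_plane_edge)

lemma partite_by_plane_edges:
  assumes "p > 0"
  shows "partite_by (Suc p) {..<Suc p * p} (plane_edges p) (plane_class p ` {..p})"
  unfolding partite_by_def
proof (intro conjI ballI)
  have base: "i * p \<in> plane_class p i" if "i \<le> p" for i
  proof -
    have "i * p \<le> p * p"
      using that by simp
    then have "i * p < Suc p * p"
      using assms unfolding mult_Suc by linarith
    then show ?thesis
      using assms by (simp add: plane_class_def)
  qed
  show "partition_on {..<Suc p * p} (plane_class p ` {..p})"
  proof (rule partition_onI)
    show "\<Union> (plane_class p ` {..p}) = {..<Suc p * p}"
    proof (intro equalityI subsetI)
      fix x assume x: "x \<in> {..<Suc p * p}"
      then have "x div p < Suc p"
        by (auto intro: less_mult_imp_div_less)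
      then show "x \<in> \<Union> (plane_class p ` {..p})"
        using x by (auto simp: plane_class_def)
    qed (auto simp: plane_class_def)
  next
    fix C D assume "C \<in> plane_class p ` {..p}" "D \<in> plane_class p ` {..p}" "C \<noteq> D"
    then show "disjnt C D"
      by (auto simp: plane_class_def disjnt_def)
  next
    show "{} \<notin> plane_class p ` {..p}"
      using base by force
  qed
  have "inj_on (plane_class p) {..p}"
  proof (rule inj_onI)
    fix i j assume "i \<in> {..p}" "j \<in> {..p}" "plane_class p i = plane_class p j"
    then have "i * p \<in> plane_class p j"
      using base[of i] by simp
    then show "i = j"
      using assms by (simp add: plane_class_def)
  qed
  then show "card (plane_class p ` {..p}) = Suc p"
    by (simp add: card_image)
next
  fix e assume "e \<in># plane_edges p"
  then obtain ab where e: "e = plane_edge p ab"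
    by (auto simp: plane_edges_def)
  show "multicolored {..<Suc p * p} (plane_class p ` {..p}) e"
    unfolding multicolored_def
  proof (intro conjI ballI)
    show "e \<subseteq> {..<Suc p * p}"
      by (auto simp: e plane_edge_def)
    fix C x y assume "C \<in> plane_class p ` {..p}" "x \<in> e \<inter> C" "y \<in> e \<inter> C"
    then have "x div p = y div p" "x mod p = y mod p"
      by (auto simp: e plane_class_def plane_edge_def)
    then show "x = y"
      by (metis div_mult_mod_eq)
  qed
qed

section \<open>Linear equations modulo a prime\<close>

lemma prime_dvd_linear:
  fixes m c :: int
  assumes "prime p" "\<not> int p dvd m"
  obtains x where "x < p" "int p dvd m * int x - c"
proof -
  have "coprime m (int p)"
    using assms by (metis coprime_commute prime_imp_coprime prime_nat_int_transfer)
  then obtain z where "[m * z = 1] (mod int p)"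
    using cong_solve_coprime_int by blast
  then have z: "int p dvd m * z - 1"
    by (simp add: cong_iff_dvd_diff)
  have p: "int p > 0"
    using assms(1) prime_gt_0_nat by auto
  \<comment> \<open>The solution is \<open>c\<close> times the inverse \<open>z\<close> of
    \<open>m\<close>, reduced to a natural number because it serves as a coordinate, while
    \<open>m\<close> and \<open>c\<close> are differences and may be negative.\<close>
  define x where "x = nat ((z * c) mod int p)"
  have x: "int x = (z * c) mod int p"
    using p by (simp add: x_def)
  have "int p dvd z * c - int x"
    unfolding x by (simp add: minus_mod_eq_mult_div)
  then have "int p dvd m * (z * c - int x)"
    by simp
  moreover have "int p dvd (m * z - 1) * c"
    using z by simp
  ultimately have "int p dvd (m * z - 1) * c - m * (z * c - int x)"
    by (rule dvd_diff[rotated])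
  then have "int p dvd m * int x - c"
    by (simp add: algebra_simps)
  moreover have "x < p"
    using x p by (metis of_nat_less_iff pos_mod_bound)
  ultimately show ?thesis
    using that by blast
qed

lemma not_dvd_diff_less:
  assumes "i < p" "j < p" "i \<noteq> j"
  shows "\<not> int p dvd int i - int j"
proof
  assume "int p dvd int i - int j"
  then have "[int i = int j] (mod int p)"
    by (simp add: cong_iff_dvd_diff)
  then show False
    using assms by (simp add: cong_int_iff cong_def)
qed

text \<open>Over the integers, congruences become linear expressions that can be subtracted and
  rearranged.\<close>

lemma mod_eq_iff_int_dvd: "x mod p = y mod p \<longleftrightarrow> int p dvd int x - int y" for x y p :: nat
  by (metis cong_def cong_iff_dvd_diff cong_int_iff)

text \<open>Lines of equal slope share the point of class \<open>p\<close> that records the slope;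
  for different slopes the common abscissa solves a linear equation modulo \<open>p\<close>.\<close>

lemma intersecting_plane_edges:
  assumes "prime p"
  shows "intersecting (plane_edges p)"
  unfolding intersecting_def
proof (intro ballI)
  fix e f assume "e \<in># plane_edges p" "f \<in># plane_edges p"
  then obtain a b a' b' where
    e: "e = plane_edge p (a, b)" "(a, b) \<in> {..<p} \<times> {..<p}" and
    f: "f = plane_edge p (a', b')" "(a', b') \<in> {..<p} \<times> {..<p}"
    by (auto simp: plane_edges_def)
  have p: "p > 0"
    using assms prime_gt_0_nat by blast
  have "\<exists>i\<le>p. line_val p (a, b) i = line_val p (a', b') i"
  proof (cases "a = a'")
    case True
    then show ?thesis
      by (intro exI[of _ p]) (simp add: line_val_def)
  next
    case False
    then have "\<not> int p dvd int a - int a'"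
      using e f by (intro not_dvd_diff_less) auto
    then obtain i where i: "i < p" "int p dvd (int a - int a') * int i - (int b' - int b)"
      using prime_dvd_linear[OF assms] by blast
    then have "(a * i + b) mod p = (a' * i + b') mod p"
      by (simp add: mod_eq_iff_int_dvd algebra_simps)
    then show ?thesis
      using i by (intro exI[of _ i]) (simp add: line_val_def)
  qed
  then show "e \<inter> f \<noteq> {}"
    unfolding e(1) f(1) plane_edge_eq_image[OF p e(2)] plane_edge_eq_image[OF p f(2)] by force
qed

section \<open>Lines through points and the sharpness count\<close>

definition lines_at :: "nat \<Rightarrow> nat \<Rightarrow> (nat \<times> nat) set" where
  "lines_at p x = {ab \<in> {..<p} \<times> {..<p}. x \<in> plane_edge p ab}"

lemma finite_lines_at: "finite (lines_at p x)"
  unfolding lines_at_def by (rule finite_subset[of _ "{..<p} \<times> {..<p}"]) auto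

text \<open>A point at infinity fixes the slope, so the intercept determines the line. At an affine
  point the slope determines the intercept.\<close>

lemma card_lines_at_le: "card (lines_at p x) \<le> p"
proof -
  have "\<exists>h. inj_on h (lines_at p x) \<and> h ` lines_at p x \<subseteq> {..<p}"
  proof (cases "x div p = p")
    case True
    then have "inj_on snd (lines_at p x)"
      by (auto simp: inj_on_def lines_at_def plane_edge_def line_val_def)
    then show ?thesis
      by (intro exI[of _ snd]) (auto simp: lines_at_def)
  next
    case False
    have "inj_on fst (lines_at p x)"
    proof (rule inj_onI)
      fix ab ab' assume *: "ab \<in> lines_at p x" "ab' \<in> lines_at p x" "fst ab = fst ab'"
      then have "(fst ab * (x div p) + snd ab) mod p = (fst ab * (x div p) + snd ab') mod p"
        using False by (auto simp: lines_at_def plane_edge_def line_val_def)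
      then have "snd ab mod p = snd ab' mod p"
        by (simp add: mod_eq_iff_int_dvd)
      then have "snd ab = snd ab'"
        using * by (auto simp: lines_at_def)
      then show "ab = ab'"
        using * by (simp add: prod_eq_iff)
    qed
    then show ?thesis
      by (intro exI[of _ fst]) (auto simp: lines_at_def)
  qed
  then show ?thesis
    by (metis card_inj_on_le card_lessThan finite_lessThan)
qed

text \<open>Finds the intercept \<open>b\<close> of a line through a given point, where
  \<open>c\<close> is slope times abscissa.\<close>

lemma exists_mod_shift:
  assumes "p > 0"
  obtains b where "b < p" "((c::nat) + b) mod p = y mod p"
proof -
  define b where "b = nat ((int y - int c) mod int p)"
  have b: "int b = (int y - int c) mod int p"
    using assms by (simp add: b_def)
  have "int p dvd (int y - int c) - int b"
    unfolding b by (simp add: minus_mod_eq_mult_div)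
  then have "int p dvd int (c + b) - int y"
    by (subst dvd_minus_iff[symmetric]) (simp add: algebra_simps)
  then have "(c + b) mod p = y mod p"
    by (simp add: mod_eq_iff_int_dvd)
  moreover have "b < p"
    using b assms by (metis of_nat_0_less_iff of_nat_less_iff pos_mod_bound)
  ultimately show ?thesis
    using that by blast
qed

text \<open>As \<open>i < j\<close>, only the second point can be at infinity, and then
  \<open>z\<close> is the slope. Otherwise the slope solves \<open>(j - i) * a = z - y\<close>
  modulo \<open>p\<close>. The first point then fixes the intercept.\<close>

lemma exists_line_through:
  assumes p: "prime p" and ij: "i < j" "j \<le> p" and yz: "y < p" "z < p"
  shows "\<exists>ab \<in> {..<p} \<times> {..<p}. line_val p ab i = y \<and> line_val p ab j = z"
proof (cases "j = p")
  case True
  obtain b where "b < p" "(z * i + b) mod p = y mod p"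
    using exists_mod_shift p prime_gt_0_nat by metis
  then show ?thesis
    using True assms by (intro bexI[of _ "(z, b)"]) (auto simp: line_val_def)
next
  case False
  then have "\<not> int p dvd int j - int i"
    using ij by (intro not_dvd_diff_less) auto
  then obtain a where a: "a < p" "int p dvd (int j - int i) * int a - (int z - int y)"
    using prime_dvd_linear[OF p] by blast
  obtain b where b: "b < p" "(a * i + b) mod p = y mod p"
    using exists_mod_shift p prime_gt_0_nat by metis
  then have "int p dvd int (a * i + b) - int y"
    by (simp add: mod_eq_iff_int_dvd)
  from dvd_add[OF this a(2)] have "int p dvd int (a * j + b) - int z"
    by (simp add: algebra_simps)
  then have "(a * j + b) mod p = z mod p"
    by (simp add: mod_eq_iff_int_dvd)
  then show ?thesis
    using a b ij False yz by (intro bexI[of _ "(a, b)"]) (auto simp: line_val_def)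
qed

lemma lines_at_Int_nonempty:
  assumes "prime p" "x < Suc p * p" "y < Suc p * p" "x div p \<noteq> y div p"
  shows "lines_at p x \<inter> lines_at p y \<noteq> {}"
proof -
  have p: "p > 0"
    using assms prime_gt_0_nat by blast
  have div: "x div p \<le> p" "y div p \<le> p"
    using assms less_mult_imp_div_less less_Suc_eq_le by blast+
  have mod: "x mod p < p" "y mod p < p"
    using p by auto
  obtain ab where "ab \<in> {..<p} \<times> {..<p}"
    "line_val p ab (x div p) = x mod p" "line_val p ab (y div p) = y mod p"
    using exists_line_through[OF assms(1) _ div(2) mod] exists_line_through[OF assms(1) _ div(1) mod(2,1)]
      assms(4) by (metis linorder_neqE_nat)
  then have "ab \<in> lines_at p x \<inter> lines_at p y"
    using assms(2,3) by (simp add: lines_at_def plane_edge_def)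
  then show ?thesis
    by blast
qed

lemma num_covered_plane_edges:
  assumes "finite T"
  shows "num_covered (plane_edges p) T = card (\<Union>x\<in>T. lines_at p x)"
proof -
  have "num_covered (plane_edges p) T
      = card {ab \<in> {..<p} \<times> {..<p}. plane_edge p ab \<inter> T \<noteq> {}}"
    by (simp add: num_covered_def plane_edges_def filter_mset_image_mset)
  also have "{ab \<in> {..<p} \<times> {..<p}. plane_edge p ab \<inter> T \<noteq> {}} = (\<Union>x\<in>T. lines_at p x)"
    by (auto simp: lines_at_def)
  finally show ?thesis .
qed

text \<open>Fix \<open>x\<close> in \<open>T\<close>. It covers at most \<open>p\<close> lines, and
  each of the other \<open>p - 1\<close> points shares a line with \<open>x\<close>, so it adds at
  most \<open>p - 1\<close> new ones.\<close>

lemma num_covered_plane_edges_le: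
  assumes p: "prime p"
    and mc: "multicolored {..<Suc p * p} (plane_class p ` {..p}) T" and card: "card T = p"
  shows "num_covered (plane_edges p) T \<le> p + (p - 1) * (p - 1)"
proof -
  have "p > 0"
    using p prime_gt_0_nat by blast
  then have fin: "finite T" and "T \<noteq> {}"
    using card card_gt_0_iff by metis+
  then obtain x where x: "x \<in> T"
    by blast
  have TV: "y < Suc p * p" if "y \<in> T" for y
    using mc that by (auto simp: multicolored_def)
  have div: "y div p \<noteq> x div p" if y: "y \<in> T - {x}" for y
  proof
    assume eq: "y div p = x div p"
    have "x div p \<le> p"
      using TV[OF x] less_mult_imp_div_less less_Suc_eq_le by blast
    then have "\<forall>u \<in> T \<inter> plane_class p (x div p). \<forall>v \<in> T \<inter> plane_class p (x div p). u = v"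
      using mc by (auto simp: multicolored_def)
    moreover have "x \<in> T \<inter> plane_class p (x div p)" "y \<in> T \<inter> plane_class p (x div p)"
      using x y eq TV by (auto simp: plane_class_def)
    ultimately show False
      using y by blast
  qed
  have le: "card (lines_at p y - lines_at p x) \<le> p - 1" if y: "y \<in> T - {x}" for y
  proof -
    have "lines_at p y \<inter> lines_at p x \<noteq> {}"
      using lines_at_Int_nonempty[OF p] TV x y div by auto
    then have "card (lines_at p y - lines_at p x) < card (lines_at p y)"
      by (intro psubset_card_mono finite_lines_at) auto
    then show ?thesis
      using card_lines_at_le[of p y] by linarith
  qed
  have "(\<Union>y\<in>T. lines_at p y) = lines_at p x \<union> (\<Union>y\<in>T - {x}. lines_at p y - lines_at p x)"
    using x by auto
  then have "card (\<Union>y\<in>T. lines_at p y)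
      \<le> card (lines_at p x) + card (\<Union>y\<in>T - {x}. lines_at p y - lines_at p x)"
    by (metis card_Un_le)
  also have "card (\<Union>y\<in>T - {x}. lines_at p y - lines_at p x)
      \<le> (\<Sum>y\<in>T - {x}. card (lines_at p y - lines_at p x))"
    using fin by (intro card_UN_le) auto
  also have "\<dots> \<le> (\<Sum>y\<in>T - {x}. p - 1)"
    using le by (rule sum_mono)
  also have "\<dots> = (p - 1) * (p - 1)"
    using x fin card by simp
  finally show ?thesis
    using card_lines_at_le[of p x] num_covered_plane_edges[OF fin, of p] by linarith
qed

lemma plane_edges_sharp:
  assumes p: "prime p"
  shows "\<exists>(V::nat set) E P.
         hypergraph V E \<and> uniform (Suc p) E \<and> partite_by (Suc p) V E P \<and> intersecting E \<and> E \<noteq> {#} \<and>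
         (\<forall>T. multicolored V P T \<and> card T = Suc p - 1 \<longrightarrow>
            real (num_covered E T) \<le> (1 - (real (Suc p) - 2) / (real (Suc p) - 1)\<^sup>2) * real (size E))"
proof -
  have p0: "p > 0"
    using p prime_gt_0_nat by blast
  have size: "size (plane_edges p) = p * p"
    by (simp add: plane_edges_def)
  \<comment> \<open>With \<open>r - 1 = p\<close> and \<open>p\<^sup>2\<close> edges, both sides
    equal \<open>p\<^sup>2 - p + 1\<close>.\<close>
  have bound: "(1 - (real (Suc p) - 2) / (real (Suc p) - 1)\<^sup>2) * real (size (plane_edges p))
      = real (p + (p - 1) * (p - 1))"
    using p0 by (simp add: size field_simps power2_eq_square)
  have "real (num_covered (plane_edges p) T)
      \<le> (1 - (real (Suc p) - 2) / (real (Suc p) - 1)\<^sup>2) * real (size (plane_edges p))"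
    if "multicolored {..<Suc p * p} (plane_class p ` {..p}) T \<and> card T = Suc p - 1" for T
    unfolding bound of_nat_le_iff using that by (intro num_covered_plane_edges_le[OF p]) auto
  moreover have "plane_edges p \<noteq> {#}"
    using size p0 by force
  ultimately show ?thesis
    using hypergraph_plane_edges[of p] uniform_plane_edges[OF p0] partite_by_plane_edges[OF p0]
      intersecting_plane_edges[OF p]
    by (intro exI[of _ "{..<Suc p * p}"] exI[of _ "plane_edges p"]
        exI[of _ "plane_class p ` {..p}"] conjI allI impI) assumption+
qed

theorem theorem6:
  "(\<forall>(r::nat) (V::'a set) E P.
      r \<ge> 2 \<and> hypergraph V E \<and> uniform r E \<and> partite_by r V E P \<and> intersecting E \<longrightarrow>
      (\<exists>T. multicolored V P T \<and> card T = r - 1 \<and>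
           real (num_covered E T) \<ge> (1 - (real r - 2) / (real r - 1)\<^sup>2) * real (size E) \<and>
           (E \<noteq> {#} \<longrightarrow> (\<exists>e\<in>#E. T \<subseteq> e))))
   \<and> infinite {r::nat. r \<ge> 2 \<and>
      (\<exists>(V::nat set) E P.
         hypergraph V E \<and> uniform r E \<and> partite_by r V E P \<and> intersecting E \<and> E \<noteq> {#} \<and>
         (\<forall>T. multicolored V P T \<and> card T = r - 1 \<longrightarrow>
            real (num_covered E T) \<le> (1 - (real r - 2) / (real r - 1)\<^sup>2) * real (size E)))}"
proof (intro conjI allI impI)
  fix r :: nat and V :: "'a set" and E P
  assume "r \<ge> 2 \<and> hypergraph V E \<and> uniform r E \<and> partite_by r V E P \<and> intersecting E"
  then show "\<exists>T. multicolored V P T \<and> card T = r - 1 \<and>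
           real (num_covered E T) \<ge> (1 - (real r - 2) / (real r - 1)\<^sup>2) * real (size E) \<and>
           (E \<noteq> {#} \<longrightarrow> (\<exists>e\<in>#E. T \<subseteq> e))"
    by (intro exists_large_multicolored_cover) auto
next
  have "infinite (Suc ` {p. prime p})"
    using primes_infinite by (simp add: finite_image_iff)
  moreover have "Suc ` {p. prime p} \<subseteq> {r::nat. r \<ge> 2 \<and>
      (\<exists>(V::nat set) E P.
         hypergraph V E \<and> uniform r E \<and> partite_by r V E P \<and> intersecting E \<and> E \<noteq> {#} \<and>
         (\<forall>T. multicolored V P T \<and> card T = r - 1 \<longrightarrow>
            real (num_covered E T) \<le> (1 - (real r - 2) / (real r - 1)\<^sup>2) * real (size E)))}"
  proof (intro subsetI, elim imageE, intro CollectI conjI)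
    fix r p assume r: "r = Suc p" and "p \<in> {p. prime p}"
    then have p: "prime p"
      by simp
    show "r \<ge> 2"
      using r prime_gt_0_nat[OF p] by simp
    show "\<exists>(V::nat set) E P.
         hypergraph V E \<and> uniform r E \<and> partite_by r V E P \<and> intersecting E \<and> E \<noteq> {#} \<and>
         (\<forall>T. multicolored V P T \<and> card T = r - 1 \<longrightarrow>
            real (num_covered E T) \<le> (1 - (real r - 2) / (real r - 1)\<^sup>2) * real (size E))"
      unfolding r by (rule plane_edges_sharp[OF p])
  qed
  ultimately show "infinite {r::nat. r \<ge> 2 \<and>
      (\<exists>(V::nat set) E P.
         hypergraph V E \<and> uniform r E \<and> partite_by r V E P \<and> intersecting E \<and> E \<noteq> {#} \<and>
         (\<forall>T. multicolored V P T \<and> card T = r - 1 \<longrightarrow>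
            real (num_covered E T) \<le> (1 - (real r - 2) / (real r - 1)\<^sup>2) * real (size E)))}"
    by (rule infinite_super[rotated])
qed

end
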